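(* Among the Zinbiel-PreLie algebras $\mathfrak{g}^{(1)}(N,\lambda,a,b)$ ($N\geq1$, $\lambda,a,b\in\mathbb{K}$, $a\neq0$, $b\notin\{-1,-2,\ldots\}$), $\mathfrak{g}^{(2)}(N,\lambda,\mu)$ and $\mathfrak{g}^{(3)}(N,\lambda,\mu)$ ($N\geq 1$, $\lambda,\mu\in\mathbb{K}$, $\mu\neq0$), and $\mathfrak{g}^{(4)}(\lambda)$ ($\lambda\in\mathbb{K}$), the ones which are Com-PreLie bialgebras for the usual coproduct $\Delta$ of $\mathbb{K}[X]$ (or, equivalently, the ones which are Zinbiel-PreLie bialgebras) are $\mathfrak{g}^{(4)}(0)$ and $\mathfrak{g}^{(1)}(1,a,1):=\mathfrak{g}^{(1)}(1,a,a,1)$ with $a\neq 0$.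
   Context: $\mathbb{K}$ is a field of characteristic zero. $\mathbb{K}[X]$ has its usual product $m$, the coproduct $\Delta$ which is the algebra morphism with $\Delta(X)=X\otimes1+1\otimes X$, and the half-product $X^i\prec X^j=\frac{i}{i+j}X^{i+j}$ ($i,j\geq1$) on its augmentation ideal. The objects are $(\mathbb{K}[X],m,\bullet)$ with, for $i,j\in\mathbb{N}$: in all four families $X^i\bullet 1=i\lambda X^i$; and for $j\geq1$: in $\mathfrak{g}^{(1)}(N,\lambda,a,b)$, $X^i\bullet X^j=\frac{ai}{\frac jN+b}X^{i+j}$ if $N\mid j$ and $0$ otherwise; in $\mathfrak{g}^{(2)}(N,\lambda,\mu)$, $X^i\bullet X^j=i\mu X^{i+N}$ if $j=N$ and $0$ otherwise; in $\mathfrak{g}^{(3)}(N,\lambda,\mu)$, $X^i\bullet X^j=i\mu X^{i+j}$ if $N\mid j$ and $0$ otherwise; in $\mathfrak{g}^{(4)}(\lambda)$, $X^i\bullet X^j=0$. Thus in $\mathfrak{g}^{(1)}(1,a,1)$, $X^i\bullet X^j=\frac{ai}{j+1}X^{i+j}$ for all $i,j\in\mathbb{N}$. A Com-PreLie algebra is a vector space $A$ with bilinear products $\cdot,\bullet$ such that $\cdot$ is commutative and associative and, for all $a,b,c$, $(a\bullet b)\bullet c-a\bullet(b\bullet c)=(a\bullet c)\bullet b-a\bullet(c\bullet b)$ and $(a\cdot b)\bullet c=(a\bullet c)\cdot b+a\cdot(b\bullet c)$. A Com-PreLie bialgebra is $(A,\cdot,\bullet,\Delta)$ such that $(A,\cdot,\bullet)$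 is a Com-PreLie algebra with a unit for $\cdot$, $(A,\cdot,\Delta)$ is a bialgebra, and $\Delta(a\bullet b)=a^{(1)}\otimes a^{(2)}\bullet b+a^{(1)}\bullet b^{(1)}\otimes a^{(2)}\cdot b^{(2)}$ for all $a,b$ (Sweedler's notation). A Zinbiel-PreLie algebra is $(A,\prec,\bullet)$ such that $(a\prec b)\prec c=a\prec(b\prec c+c\prec b)$, $\bullet$ satisfies the pre-Lie identity above, and $(a\prec b)\bullet c=(a\bullet c)\prec b+a\prec(b\bullet c)$. A Zinbiel-PreLie bialgebra is $(A,\cdot,\prec,\bullet,\Delta)$ such that: $(A,\cdot,\bullet,\Delta)$ is a Com-PreLie bialgebra, with augmentation ideal $A_+$ and reduced coproduct $\tilde\Delta(a)=\Delta(a)-a\otimes1-1\otimes a=a'\otimes a''$ on $A_+$; $(A_+,\prec,\bullet)$ is a Zinbiel-PreLie algebra with $x\prec y+y\prec x=x\cdot y$ for $x,y\in A_+$; and for all $a,b\in A_+$, $\tilde\Delta(a\prec b)=a'\prec b'\otimes a''\cdot b''+a'\prec b\otimes a''+a'\otimes a''\cdot b+a\prec b'\otimes b''+a\otimes b$. *)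

theory Defs
  imports "HOL-Computational_Algebra.Polynomial"
begin

section \<open>Com-PreLie and Zinbiel-PreLie algebras\<close>

definition bilinear_on ::
    "('k::field \<Rightarrow> 'a::ab_group_add \<Rightarrow> 'a) \<Rightarrow> 'a set \<Rightarrow> ('a \<Rightarrow> 'a \<Rightarrow> 'a) \<Rightarrow> bool" where
  "bilinear_on scale V f \<longleftrightarrow>
     (\<forall>x\<in>V. \<forall>y\<in>V. f x y \<in> V) \<and>
     (\<forall>x\<in>V. \<forall>y\<in>V. \<forall>z\<in>V. f (x + y) z = f x z + f y z \<and> f x (y + z) = f x y + f x z) \<and>
     (\<forall>c. \<forall>x\<in>V. \<forall>y\<in>V. f (scale c x) y = scale c (f x y) \<and> f x (scale c y) = scale c (f x y))"

definition prelie_on :: "'a::ab_group_add set \<Rightarrow> ('a \<Rightarrow> 'a \<Rightarrow> 'a) \<Rightarrow> bool" where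
  "prelie_on V bullet \<longleftrightarrow>
     (\<forall>a\<in>V. \<forall>b\<in>V. \<forall>c\<in>V.
        bullet (bullet a b) c - bullet a (bullet b c) = bullet (bullet a c) b - bullet a (bullet c b))"

definition com_prelie_algebra ::
    "('k::field \<Rightarrow> 'a::ab_group_add \<Rightarrow> 'a) \<Rightarrow> ('a \<Rightarrow> 'a \<Rightarrow> 'a) \<Rightarrow> ('a \<Rightarrow> 'a \<Rightarrow> 'a) \<Rightarrow> bool" where
  "com_prelie_algebra scale mul bullet \<longleftrightarrow>
     vector_space scale \<and> bilinear_on scale UNIV mul \<and> bilinear_on scale UNIV bullet \<and>
     (\<forall>a b. mul a b = mul b a) \<and>
     (\<forall>a b c. mul (mul a b) c = mul a (mul b c)) \<and>
     prelie_on UNIV bullet \<and>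
     (\<forall>a b c. bullet (mul a b) c = mul (bullet a c) b + mul a (bullet b c))"

text \<open>The underlying space is the subspace \<^term>\<open>V\<close>, since this will be applied to augmentation
  ideals; the values of the products outside \<^term>\<open>V\<close> are irrelevant.\<close>

definition zinbiel_prelie_algebra ::
    "('k::field \<Rightarrow> 'a::ab_group_add \<Rightarrow> 'a) \<Rightarrow> 'a set \<Rightarrow> ('a \<Rightarrow> 'a \<Rightarrow> 'a) \<Rightarrow> ('a \<Rightarrow> 'a \<Rightarrow> 'a) \<Rightarrow> bool" where
  "zinbiel_prelie_algebra scale V prec bullet \<longleftrightarrow>
     vector_space scale \<and> module.subspace scale V \<and>
     bilinear_on scale V prec \<and> bilinear_on scale V bullet \<and>
     (\<forall>a\<in>V. \<forall>b\<in>V. \<forall>c\<in>V. prec (prec a b) c = prec a (prec b c + prec c b)) \<and>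
     prelie_on V bullet \<and>
     (\<forall>a\<in>V. \<forall>b\<in>V. \<forall>c\<in>V. bullet (prec a b) c = prec (bullet a c) b + prec a (bullet b c))"


section \<open>Tensor powers of \<open>K[X]\<close>\<close>

text \<open>For a vector space \<open>V\<close>, the tensor product of \<open>V\<close> and \<open>K[X]\<close> is realised as the space \<open>V[Y]\<close>
  of polynomials with coefficients in \<open>V\<close>, where \<open>v \<otimes> X^n\<close> is \<open>v Y^n\<close>. The universal property is
  lemma \<open>tensor_poly_universal\<close> below.\<close>

definition tensor_poly :: "('k::field \<Rightarrow> 'v::zero \<Rightarrow> 'v) \<Rightarrow> 'v \<Rightarrow> 'k poly \<Rightarrow> 'v poly" where
  "tensor_poly scale v q = map_poly (\<lambda>c. scale c v) q"

definition tensor :: "'k::field poly \<Rightarrow> 'k poly \<Rightarrow> 'k poly poly"  (infixr \<open>\<otimes>\<close> 75) where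
  "p \<otimes> q = tensor_poly smult p q"

abbreviation scale2 :: "'k::field \<Rightarrow> 'k poly poly \<Rightarrow> 'k poly poly" where
  "scale2 c \<equiv> smult [:c:]"

definition tensor3 :: "'k::field poly \<Rightarrow> 'k poly \<Rightarrow> 'k poly \<Rightarrow> 'k poly poly poly" where
  "tensor3 p q r = tensor_poly scale2 (p \<otimes> q) r"

lemma vector_space_smult: "vector_space (smult :: 'k::field \<Rightarrow> 'k poly \<Rightarrow> 'k poly)"
  by unfold_locales (simp_all add: smult_add_right smult_add_left)

lemma vector_space_map_poly:
  assumes "vector_space scale"
  shows "vector_space (\<lambda>c. map_poly (scale c))"
proof -
  interpret V: vector_space scale by fact
  show ?thesis
    by unfold_locales (auto intro!: poly_eqI simp: coeff_map_poly V.scale_left_distrib V.scale_right_distrib)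
qed

lemma scale2_conv_map_poly: "scale2 c = map_poly (smult c)"
  by (auto intro!: ext poly_eqI simp: coeff_map_poly)

lemma vector_space_scale2: "vector_space (scale2 :: 'k::field \<Rightarrow> _)"
  using vector_space_map_poly[OF vector_space_smult] by (simp add: scale2_conv_map_poly)

lemma degree_map_poly_le: "f 0 = 0 \<Longrightarrow> degree (map_poly f p) \<le> degree p"
  by (simp add: degree_le coeff_eq_0 coeff_map_poly)

lemma tensor_poly_universal:
  fixes scaleV :: "'k::field \<Rightarrow> 'v::ab_group_add \<Rightarrow> 'v"
    and scaleW :: "'k \<Rightarrow> 'w::ab_group_add \<Rightarrow> 'w"
    and f :: "'v \<Rightarrow> 'k poly \<Rightarrow> 'w"
  assumes V: "vector_space scaleV" and W: "vector_space scaleW"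
    and f1: "\<And>q. Vector_Spaces.linear scaleV scaleW (\<lambda>v. f v q)"
    and f2: "\<And>v. Vector_Spaces.linear smult scaleW (f v)"
  shows "\<exists>!g. Vector_Spaces.linear (\<lambda>c. map_poly (scaleV c)) scaleW g \<and>
              (\<forall>v q. g (tensor_poly scaleV v q) = f v q)"
proof -
  interpret V: vector_space scaleV by fact
  interpret W: vector_space scaleW by fact
  interpret VX: vector_space "\<lambda>c. map_poly (scaleV c)" by (rule vector_space_map_poly[OF V])
  have f1a: "f (v + w) q = f v q + f w q" for v w q
    using f1[of q] unfolding Vector_Spaces.linear_iff by blast
  have f1s: "f (scaleV c v) q = scaleW c (f v q)" for c v q
    using f1[of q] unfolding Vector_Spaces.linear_iff by blast
  have f2a: "f v (p + q) = f v p + f v q" for v p q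
    using f2[of v] unfolding Vector_Spaces.linear_iff by blast
  have f2s: "f v (smult c q) = scaleW c (f v q)" for c v q
    using f2[of v] unfolding Vector_Spaces.linear_iff by blast
  have f10: "f 0 q = 0" for q using f1s[of 0 0 q] by simp
  have f20: "f v 0 = 0" for v using f2s[of v 0 0] by simp
  have f2sum: "f v (sum h A) = (\<Sum>i\<in>A. f v (h i))" for v and h :: "nat \<Rightarrow> 'k poly" and A
    by (induction A rule: infinite_finite_induct) (auto simp: f20 f2a)
  define g where "g t = (\<Sum>j\<le>degree t. f (coeff t j) (monom 1 j))" for t :: "'v poly"
  have g_eq: "g t = (\<Sum>j\<le>n. f (coeff t j) (monom 1 j))" if "degree t \<le> n" for t n
    unfolding g_def using that
    by (intro sum.mono_neutral_left) (auto simp: f10 coeff_eq_0)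
  have g_add: "g (s + t) = g s + g t" for s t
  proof -
    let ?n = "max (degree s) (degree t)"
    have "degree (s + t) \<le> ?n" by (rule degree_add_le_max)
    then show ?thesis by (subst (1 2 3) g_eq[of _ ?n]) (auto simp: f1a sum.distrib)
  qed
  have g_scale: "g (map_poly (scaleV c) t) = scaleW c (g t)" for c t
    by (subst (1 2) g_eq[of _ "degree t"])
      (auto simp: f1s coeff_map_poly W.scale_sum_right degree_map_poly_le)
  have g_tensor: "g (tensor_poly scaleV v q) = f v q" for v q
  proof -
    have "g (tensor_poly scaleV v q) = (\<Sum>j\<le>degree q. scaleW (coeff q j) (f v (monom 1 j)))"
      by (subst g_eq[of _ "degree q"])
        (auto simp: tensor_poly_def coeff_map_poly f1s degree_map_poly_le)
    also have "\<dots> = f v (\<Sum>j\<le>degree q. monom (coeff q j) j)"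
      by (auto simp: f2sum smult_monom simp flip: f2s)
    finally show ?thesis by (simp add: poly_as_sum_of_monoms)
  qed
  have g_lin: "Vector_Spaces.linear (\<lambda>c. map_poly (scaleV c)) scaleW g"
    using g_add g_scale VX.vector_space_axioms W unfolding Vector_Spaces.linear_iff by blast
  show ?thesis
  proof (rule ex1I[of _ g])
    show "Vector_Spaces.linear (\<lambda>c. map_poly (scaleV c)) scaleW g \<and>
        (\<forall>v q. g (tensor_poly scaleV v q) = f v q)"
      using g_lin g_tensor by blast
  next
    fix h assume h: "Vector_Spaces.linear (\<lambda>c. map_poly (scaleV c)) scaleW h \<and>
        (\<forall>v q. h (tensor_poly scaleV v q) = f v q)"
    have ha: "h (s + t) = h s + h t" for s t using h unfolding Vector_Spaces.linear_iff by blast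
    have h0: "h 0 = 0" using ha[of 0 0] by simp
    have hsum: "h (sum k A) = (\<Sum>i\<in>A. h (k i))" for k :: "nat \<Rightarrow> 'v poly" and A
      by (induction A rule: infinite_finite_induct) (auto simp: h0 ha)
    have "h t = g t" for t
    proof -
      have *: "monom v j = tensor_poly scaleV v (monom 1 j)" for v j
        by (auto intro!: poly_eqI simp: tensor_poly_def coeff_map_poly)
      have "h t = h (\<Sum>j\<le>degree t. monom (coeff t j) j)" by (simp add: poly_as_sum_of_monoms)
      also have "\<dots> = g t" using h by (simp add: hsum * g_def)
      finally show ?thesis .
    qed
    then show "h = g" by blast
  qed
qed

corollary tensor_universal:
  fixes scaleW :: "'k::field \<Rightarrow> 'w::ab_group_add \<Rightarrow> 'w" and f :: "'k poly \<Rightarrow> 'k poly \<Rightarrow> 'w"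
  assumes "vector_space scaleW"
    and "\<And>q. Vector_Spaces.linear smult scaleW (\<lambda>p. f p q)"
    and "\<And>p. Vector_Spaces.linear smult scaleW (f p)"
  shows "\<exists>!g. Vector_Spaces.linear scale2 scaleW g \<and> (\<forall>p q. g (p \<otimes> q) = f p q)"
  using tensor_poly_universal[OF vector_space_smult assms]
  by (simp add: tensor_def scale2_conv_map_poly)

text \<open>Sweedler's notation: \<^term>\<open>s\<close> chooses, for every \<^term>\<open>a \<in> V\<close>, a presentation of \<^term>\<open>D a\<close> as a
  finite sum of pure tensors of elements of \<^term>\<open>V\<close>. An identity in Sweedler's notation is
  required for all such choices.\<close>

definition sweedler ::
    "'k::field poly set \<Rightarrow> ('k poly \<Rightarrow> 'k poly poly) \<Rightarrow> ('k poly \<Rightarrow> ('k poly \<times> 'k poly) list) \<Rightarrow> bool" where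
  "sweedler V D s \<longleftrightarrow> (\<forall>a\<in>V. set (s a) \<subseteq> V \<times> V \<and> D a = (\<Sum>(x, y)\<leftarrow>s a. x \<otimes> y))"

lemma sweedler_exists: "\<exists>s. sweedler UNIV D s"
proof -
  have *: "\<exists>xs. t = (\<Sum>(x, y)\<leftarrow>xs. x \<otimes> y)" for t :: "'k::field poly poly"
  proof -
    have "monom (coeff t j) j = coeff t j \<otimes> monom 1 j" for j
      by (auto intro!: poly_eqI simp: tensor_def tensor_poly_def coeff_map_poly)
    then have "t = (\<Sum>j\<le>degree t. coeff t j \<otimes> monom 1 j)"
      by (metis (no_types, lifting) poly_as_sum_of_monoms sum.cong)
    also have "\<dots> = (\<Sum>(x, y)\<leftarrow>map (\<lambda>j. (coeff t j, monom 1 j)) [0..<Suc (degree t)]. x \<otimes> y)"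
      using sum_set_upt_conv_sum_list_nat[of "\<lambda>j. coeff t j \<otimes> monom 1 j" 0 "Suc (degree t)"]
      by (simp add: o_def atLeast0LessThan lessThan_Suc_atMost del: upt_Suc)
    finally show ?thesis by blast
  qed
  show ?thesis unfolding sweedler_def by (simp, rule choice) (use * in blast)
qed


section \<open>Bialgebras on the vector space \<open>K[X]\<close>\<close>

definition bialgebra ::
    "('k::field poly \<Rightarrow> 'k poly \<Rightarrow> 'k poly) \<Rightarrow> 'k poly \<Rightarrow>
     ('k poly \<Rightarrow> 'k poly poly) \<Rightarrow> ('k poly \<Rightarrow> 'k) \<Rightarrow> bool" where
  "bialgebra mul one \<Delta> \<epsilon> \<longleftrightarrow>
     bilinear_on smult UNIV mul \<and>
     (\<forall>a b c. mul (mul a b) c = mul a (mul b c)) \<and>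
     (\<forall>a. mul one a = a \<and> mul a one = a) \<and>
     Vector_Spaces.linear smult scale2 \<Delta> \<and>
     Vector_Spaces.linear smult (*) \<epsilon> \<and>
     \<Delta> one = one \<otimes> one \<and> \<epsilon> one = 1 \<and>
     (\<forall>a b. \<epsilon> (mul a b) = \<epsilon> a * \<epsilon> b) \<and>
     (\<forall>s. sweedler UNIV \<Delta> s \<longrightarrow>
        (\<forall>a. (\<Sum>(a1, a2)\<leftarrow>s a. \<Sum>(x, y)\<leftarrow>s a1. tensor3 x y a2) =
             (\<Sum>(a1, a2)\<leftarrow>s a. \<Sum>(x, y)\<leftarrow>s a2. tensor3 a1 x y)) \<and>
        (\<forall>a. (\<Sum>(a1, a2)\<leftarrow>s a. smult (\<epsilon> a1) a2) = a \<and> (\<Sum>(a1, a2)\<leftarrow>s a. smult (\<epsilon> a2) a1) = a) \<and>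
        (\<forall>a b. \<Delta> (mul a b) = (\<Sum>(a1, a2)\<leftarrow>s a. \<Sum>(b1, b2)\<leftarrow>s b. mul a1 b1 \<otimes> mul a2 b2)))"

definition com_prelie_bialgebra ::
    "('k::field poly \<Rightarrow> 'k poly \<Rightarrow> 'k poly) \<Rightarrow> 'k poly \<Rightarrow> ('k poly \<Rightarrow> 'k poly \<Rightarrow> 'k poly) \<Rightarrow>
     ('k poly \<Rightarrow> 'k poly poly) \<Rightarrow> ('k poly \<Rightarrow> 'k) \<Rightarrow> bool" where
  "com_prelie_bialgebra mul one bullet \<Delta> \<epsilon> \<longleftrightarrow>
     com_prelie_algebra smult mul bullet \<and>
     bialgebra mul one \<Delta> \<epsilon> \<and>
     (\<forall>s. sweedler UNIV \<Delta> s \<longrightarrow>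
        (\<forall>a b. \<Delta> (bullet a b) =
           (\<Sum>(a1, a2)\<leftarrow>s a. a1 \<otimes> bullet a2 b) +
           (\<Sum>(a1, a2)\<leftarrow>s a. \<Sum>(b1, b2)\<leftarrow>s b. bullet a1 b1 \<otimes> mul a2 b2)))"

definition reduced_coproduct ::
    "'k::field poly \<Rightarrow> ('k poly \<Rightarrow> 'k poly poly) \<Rightarrow> 'k poly \<Rightarrow> 'k poly poly" where
  "reduced_coproduct one \<Delta> a = \<Delta> a - a \<otimes> one - one \<otimes> a"

definition augmentation_ideal :: "('k::field poly \<Rightarrow> 'k) \<Rightarrow> 'k poly set" where
  "augmentation_ideal \<epsilon> = {a. \<epsilon> a = 0}"

definition zinbiel_prelie_bialgebra ::
    "('k::field poly \<Rightarrow> 'k poly \<Rightarrow> 'k poly) \<Rightarrow> 'k poly \<Rightarrow> ('k poly \<Rightarrow> 'k poly \<Rightarrow> 'k poly) \<Rightarrow>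
     ('k poly \<Rightarrow> 'k poly \<Rightarrow> 'k poly) \<Rightarrow> ('k poly \<Rightarrow> 'k poly poly) \<Rightarrow> ('k poly \<Rightarrow> 'k) \<Rightarrow> bool" where
  "zinbiel_prelie_bialgebra mul one prec bullet \<Delta> \<epsilon> \<longleftrightarrow>
     com_prelie_bialgebra mul one bullet \<Delta> \<epsilon> \<and>
     zinbiel_prelie_algebra smult (augmentation_ideal \<epsilon>) prec bullet \<and>
     (\<forall>x\<in>augmentation_ideal \<epsilon>. \<forall>y\<in>augmentation_ideal \<epsilon>. prec x y + prec y x = mul x y) \<and>
     (\<forall>s. sweedler (augmentation_ideal \<epsilon>) (reduced_coproduct one \<Delta>) s \<longrightarrow>
        (\<forall>a\<in>augmentation_ideal \<epsilon>. \<forall>b\<in>augmentation_ideal \<epsilon>.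
           reduced_coproduct one \<Delta> (prec a b) =
             (\<Sum>(a1, a2)\<leftarrow>s a. \<Sum>(b1, b2)\<leftarrow>s b. prec a1 b1 \<otimes> mul a2 b2) +
             (\<Sum>(a1, a2)\<leftarrow>s a. prec a1 b \<otimes> a2) +
             (\<Sum>(a1, a2)\<leftarrow>s a. a1 \<otimes> mul a2 b) +
             (\<Sum>(b1, b2)\<leftarrow>s b. prec a b1 \<otimes> b2) +
             a \<otimes> b))"


section \<open>The structures on \<open>K[X]\<close>\<close>

definition bilinear_extension ::
    "(nat \<Rightarrow> nat \<Rightarrow> 'k::field poly) \<Rightarrow> 'k poly \<Rightarrow> 'k poly \<Rightarrow> 'k poly" where
  "bilinear_extension F p q =
     (\<Sum>i\<le>degree p. \<Sum>j\<le>degree q. smult (coeff p i * coeff q j) (F i j))"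

definition comult :: "'k::field poly \<Rightarrow> 'k poly poly" where
  "comult p = poly (map_poly (\<lambda>c. [:[:c:]:]) p) ([:0, 1:] \<otimes> 1 + 1 \<otimes> [:0, 1:])"

definition counit :: "'k::field poly \<Rightarrow> 'k" where
  "counit p = poly p 0"

text \<open>Only meaningful on the augmentation ideal, i.e. for \<open>i, j \<ge> 1\<close>.\<close>

definition half_prod :: "'k::field poly \<Rightarrow> 'k poly \<Rightarrow> 'k poly" where
  "half_prod = bilinear_extension (\<lambda>i j. monom (of_nat i / of_nat (i + j)) (i + j))"

definition g1 :: "nat \<Rightarrow> 'k::field \<Rightarrow> 'k \<Rightarrow> 'k \<Rightarrow> 'k poly \<Rightarrow> 'k poly \<Rightarrow> 'k poly" where
  "g1 N l a b = bilinear_extension (\<lambda>i j.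
     if j = 0 then monom (of_nat i * l) i
     else if N dvd j then monom (a * of_nat i / (of_nat j / of_nat N + b)) (i + j) else 0)"

definition g2 :: "nat \<Rightarrow> 'k::field \<Rightarrow> 'k \<Rightarrow> 'k poly \<Rightarrow> 'k poly \<Rightarrow> 'k poly" where
  "g2 N l \<mu> = bilinear_extension (\<lambda>i j.
     if j = 0 then monom (of_nat i * l) i
     else if j = N then monom (of_nat i * \<mu>) (i + N) else 0)"

definition g3 :: "nat \<Rightarrow> 'k::field \<Rightarrow> 'k \<Rightarrow> 'k poly \<Rightarrow> 'k poly \<Rightarrow> 'k poly" where
  "g3 N l \<mu> = bilinear_extension (\<lambda>i j.
     if j = 0 then monom (of_nat i * l) i
     else if N dvd j then monom (of_nat i * \<mu>) (i + j) else 0)"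

definition g4 :: "'k::field \<Rightarrow> 'k poly \<Rightarrow> 'k poly \<Rightarrow> 'k poly" where
  "g4 l = bilinear_extension (\<lambda>i j. if j = 0 then monom (of_nat i * l) i else 0)"

abbreviation is_com_prelie_bialgebra :: "('k::field poly \<Rightarrow> 'k poly \<Rightarrow> 'k poly) \<Rightarrow> bool" where
  "is_com_prelie_bialgebra bullet \<equiv> com_prelie_bialgebra (*) 1 bullet comult counit"

abbreviation is_zinbiel_prelie_bialgebra :: "('k::field poly \<Rightarrow> 'k poly \<Rightarrow> 'k poly) \<Rightarrow> bool" where
  "is_zinbiel_prelie_bialgebra bullet \<equiv>
     zinbiel_prelie_bialgebra (*) 1 half_prod bullet comult counit"


section \<open>The four families consist of Zinbiel-PreLie algebras\<close>

lemma smult_sum_right: "smult c (sum h A) = (\<Sum>i\<in>A. smult c (h i))"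
  by (induction A rule: infinite_finite_induct) (auto simp: smult_add_right)

lemma bilinear_extension_eq:
  assumes "degree p \<le> m" "degree q \<le> n"
  shows "bilinear_extension F p q = (\<Sum>i\<le>m. \<Sum>j\<le>n. smult (coeff p i * coeff q j) (F i j))"
proof -
  have "(\<Sum>i\<le>m. \<Sum>j\<le>n. smult (coeff p i * coeff q j) (F i j)) =
        (\<Sum>i\<le>m. \<Sum>j\<le>degree q. smult (coeff p i * coeff q j) (F i j))"
    using assms(2) by (intro sum.cong refl sum.mono_neutral_right) (auto simp: coeff_eq_0)
  also have "\<dots> = bilinear_extension F p q"
    unfolding bilinear_extension_def using assms(1)
    by (intro sum.mono_neutral_right) (auto simp: coeff_eq_0)
  finally show ?thesis ..
qed

lemma bilinear_extension_monom:
  "bilinear_extension F (monom c i) (monom d j) = smult (c * d) (F i j)"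
proof -
  have "bilinear_extension F (monom c i) (monom d j) =
    (\<Sum>i'\<le>i. \<Sum>j'\<le>j. smult (coeff (monom c i) i' * coeff (monom d j) j') (F i' j'))"
    by (rule bilinear_extension_eq) (rule degree_monom_le)+
  also have "\<dots> = (\<Sum>i'\<le>i. \<Sum>j'\<le>j. if j' = j then smult (coeff (monom c i) i' * d) (F i' j) else 0)"
    by (intro sum.cong) auto
  also have "\<dots> = (\<Sum>i'\<le>i. if i' = i then smult (c * d) (F i j) else 0)"
    by (intro sum.cong) (auto)
  finally show ?thesis by simp
qed

lemma bilinear_extension_add_left:
  "bilinear_extension F (p + q) r = bilinear_extension F p r + bilinear_extension F q r"
proof -
  let ?n = "max (degree p) (degree q)"
  have "degree (p + q) \<le> ?n" by (rule degree_add_le_max)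
  then show ?thesis
    by (subst (1 2 3) bilinear_extension_eq[of _ ?n _ "degree r"])
      (auto simp: sum.distrib smult_add_left algebra_simps)
qed

lemma bilinear_extension_add_right:
  "bilinear_extension F r (p + q) = bilinear_extension F r p + bilinear_extension F r q"
proof -
  let ?n = "max (degree p) (degree q)"
  have "degree (p + q) \<le> ?n" by (rule degree_add_le_max)
  then show ?thesis
    by (subst (1 2 3) bilinear_extension_eq[of _ "degree r" _ ?n])
      (auto simp: sum.distrib smult_add_left algebra_simps)
qed

lemma bilinear_extension_smult_left:
  "bilinear_extension F (smult c p) r = smult c (bilinear_extension F p r)"
  by (subst (1 2) bilinear_extension_eq[of _ "degree p" _ "degree r"])
    (auto simp: smult_sum_right mult.assoc)

lemma bilinear_extension_smult_right:
  "bilinear_extension F r (smult c p) = smult c (bilinear_extension F r p)"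
  by (subst (1 2) bilinear_extension_eq[of _ "degree r" _ "degree p"])
    (auto simp: smult_sum_right mult_ac)

lemmas bilinear_extension_simps =
  bilinear_extension_add_left bilinear_extension_add_right
  bilinear_extension_smult_left bilinear_extension_smult_right bilinear_extension_monom

lemma monom_add_induct:
  assumes "\<And>c n. P (monom c n)" "\<And>p q. P p \<Longrightarrow> P q \<Longrightarrow> P (p + q)"
  shows "P (p :: 'k::comm_monoid_add poly)"
proof -
  have "P (\<Sum>i\<le>n. monom (coeff p i) i)" for n
    by (induction n) (auto intro: assms)
  then show ?thesis by (metis poly_as_sum_of_monoms)
qed

lemma augmentation_ideal_induct [consumes 1, case_names monom add]:
  fixes p :: "'k::field poly"
  assumes "p \<in> augmentation_ideal counit"
    and "\<And>c n. n \<ge> 1 \<Longrightarrow> P (monom c n)" "\<And>p q. P p \<Longrightarrow> P q \<Longrightarrow> P (p + q)"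
  shows "P p"
proof -
  have c0: "coeff p 0 = 0" using assms(1) by (simp add: augmentation_ideal_def counit_def poly_0_coeff_0)
  have P0: "P 0" using assms(2)[of 1 0] by simp
  have "P (\<Sum>i\<le>n. monom (coeff p i) i)" for n
  proof (induction n)
    case (Suc n)
    then show ?case using assms(3)[OF Suc assms(2)] by simp
  qed (simp add: P0 c0)
  then show ?thesis by (metis poly_as_sum_of_monoms)
qed

lemma counit_bilinear_extension:
  assumes "p \<in> augmentation_ideal counit" "\<And>i j. i \<ge> 1 \<Longrightarrow> coeff (F i j) 0 = 0"
  shows "bilinear_extension F p q \<in> augmentation_ideal counit"
proof -
  have "coeff p 0 = 0"
    using assms(1) by (simp add: augmentation_ideal_def counit_def poly_0_coeff_0)
  then have "coeff p i * coeff q j * coeff (F i j) 0 = 0" for i j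
    using assms(2)[of i j] by (cases i) auto
  then show ?thesis
    unfolding augmentation_ideal_def counit_def poly_0_coeff_0 bilinear_extension_def coeff_sum mem_Collect_eq coeff_smult
    by (simp del: mult_eq_0_iff)
qed

lemma bilinear_on_bilinear_extension:
  assumes "\<And>i j. i \<ge> 1 \<Longrightarrow> coeff (F i j) 0 = 0"
  shows "bilinear_on smult (augmentation_ideal counit) (bilinear_extension F)"
  using assms unfolding bilinear_on_def
  by (auto simp: bilinear_extension_simps intro: counit_bilinear_extension)

lemma zinbiel_prelie_family:
  fixes f :: "nat \<Rightarrow> 'k::field_char_0"
  assumes f: "\<And>j k. j \<ge> 1 \<Longrightarrow> k \<ge> 1 \<Longrightarrow>
      f j * f k * (of_nat j - of_nat k) = f (j + k) * (of_nat j * f k - of_nat k * f j)"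
  defines "B \<equiv> bilinear_extension (\<lambda>i j. monom (of_nat i * f j) (i + j))"
  shows "zinbiel_prelie_algebra smult (augmentation_ideal counit) half_prod B"
  unfolding zinbiel_prelie_algebra_def
proof (intro conjI ballI)
  let ?A = "augmentation_ideal counit :: 'k poly set"
  show "vector_space (smult :: 'k \<Rightarrow> _)" by (rule vector_space_smult)
  then interpret vector_space "smult :: 'k \<Rightarrow> _" .
  show "subspace ?A" by (auto simp: subspace_def augmentation_ideal_def counit_def)
  show "bilinear_on smult ?A half_prod" "bilinear_on smult ?A B"
    unfolding half_prod_def B_def by (auto intro!: bilinear_on_bilinear_extension)
  have half: "half_prod (monom c i) (monom d j) =
      monom (c * d * of_nat i / (of_nat i + of_nat j)) (i + j)" for c d :: 'k and i j
    by (simp add: half_prod_def bilinear_extension_monom smult_monom)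
  have bul: "B (monom c i) (monom d j) = monom (c * d * of_nat i * f j) (i + j)" for c d i j
    by (simp add: B_def bilinear_extension_monom smult_monom mult.assoc)
  have lin: "half_prod (p + q) r = half_prod p r + half_prod q r"
     "half_prod r (p + q) = half_prod r p + half_prod r q"
     "B (p + q) r = B p r + B q r" "B r (p + q) = B r p + B r q" for p q r
    by (auto simp: half_prod_def B_def bilinear_extension_simps)
  have nz: "of_nat i + of_nat j \<noteq> (0::'k)" "of_nat i + (of_nat j + of_nat k) \<noteq> (0::'k)"
    if "i \<ge> 1" for i j k
    using that by (simp_all flip: of_nat_add)
  show "half_prod (half_prod a b) c = half_prod a (half_prod b c + half_prod c b)"
    if "a \<in> ?A" "b \<in> ?A" "c \<in> ?A" for a b c
    using that(1)
  proof (induction a rule: augmentation_ideal_induct)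
    case (monom x i)
    note i = monom
    show ?case using that(2)
    proof (induction b rule: augmentation_ideal_induct)
      case (monom y j)
      note j = monom
      show ?case using that(3)
      proof (induction c rule: augmentation_ideal_induct)
        case (monom z k)
        have e: "k + j = j + k" "i + j + k = i + (j + k)" by simp_all
        have s: "of_nat k + of_nat j = (of_nat j + of_nat k :: 'k)"
          "of_nat i + of_nat j + of_nat k = (of_nat i + (of_nat j + of_nat k) :: 'k)" by simp_all
        have "half_prod (monom y j) (monom z k) + half_prod (monom z k) (monom y j) = monom (y * z) (j + k)"
          using nz(1)[OF j(1), of k]
          by (simp add: half add_monom e s mult.commute[of z] flip: add_divide_distrib distrib_left)
        then show ?case using nz(1)[OF i(1), of j] nz(2)[OF i(1), of j k]
          by (simp add: half e s)
      qed (simp add: lin algebra_simps)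
    qed (simp add: lin algebra_simps)
  qed (simp add: lin algebra_simps)
  show "prelie_on ?A B"
    unfolding prelie_on_def
  proof (intro ballI)
    fix a b c assume *: "a \<in> ?A" "b \<in> ?A" "c \<in> ?A"
    from *(1) show "B (B a b) c - B a (B b c) = B (B a c) b - B a (B c b)"
    proof (induction a rule: augmentation_ideal_induct)
      case (monom x i)
      from *(2) show ?case
      proof (induction b rule: augmentation_ideal_induct)
        case (monom y j)
        note j = monom
        from *(3) show ?case
        proof (induction c rule: augmentation_ideal_induct)
          case (monom z k)
          have e: "k + j = j + k" "i + j + k = i + (j + k)" "i + k + j = i + (j + k)" by simp_all
          have "x * y * of_nat i * f j * z * of_nat (i + j) * f k - x * (y * z * of_nat j * f k) * of_nat i * f (j + k)
              - (x * z * of_nat i * f k * y * of_nat (i + k) * f j - x * (z * y * of_nat k * f j) * of_nat i * f (j + k))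
             = x * y * z * of_nat i * (f j * f k * (of_nat j - of_nat k) - f (j + k) * (of_nat j * f k - of_nat k * f j))"
            by (simp add: algebra_simps)
          also have "\<dots> = 0" using f[OF j(1) monom(1)] by simp
          finally show ?case by (simp add: bul e diff_monom)
        qed (simp add: lin algebra_simps)
      qed (simp add: lin algebra_simps)
    qed (simp add: lin algebra_simps)
  qed
  show "B (half_prod a b) c = half_prod (B a c) b + half_prod a (B b c)"
    if "a \<in> ?A" "b \<in> ?A" "c \<in> ?A" for a b c
    using that(1)
  proof (induction a rule: augmentation_ideal_induct)
    case (monom x i)
    note i = monom
    show ?case using that(2)
    proof (induction b rule: augmentation_ideal_induct)
      case (monom y j)
      note j = monom
      show ?case using that(3)
      proof (induction c rule: augmentation_ideal_induct)
        case (monom z k)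
        have e: "i + k + j = i + j + k" "i + (j + k) = i + j + k" by simp_all
        have s: "of_nat i + of_nat j \<noteq> (0::'k)" "of_nat i + of_nat j + of_nat k \<noteq> (0::'k)"
          "of_nat i + of_nat k + of_nat j = (of_nat i + of_nat j + of_nat k :: 'k)"
          "of_nat i + (of_nat j + of_nat k) = (of_nat i + of_nat j + of_nat k :: 'k)"
          using nz(1)[OF i(1), of j] nz(2)[OF i(1), of j k] by (simp_all only: add_ac not_False_eq_True)
        show ?case using s(1,2)
          by (simp add: half bul lin add_monom e s(3,4) flip: add_divide_distrib)
             (simp add: field_simps)
      qed (simp add: lin algebra_simps)
    qed (simp add: lin algebra_simps)
  qed (simp add: lin algebra_simps)
qed

lemma zinbiel_prelie_family':
  fixes f :: "nat \<Rightarrow> 'k::field_char_0"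
  assumes "\<And>i j. F i j = monom (of_nat i * f j) (i + j)"
    and "\<And>j k. j \<ge> 1 \<Longrightarrow> k \<ge> 1 \<Longrightarrow>
      f j * f k * (of_nat j - of_nat k) = f (j + k) * (of_nat j * f k - of_nat k * f j)"
  shows "zinbiel_prelie_algebra smult (augmentation_ideal counit) half_prod (bilinear_extension F)"
proof -
  have "F = (\<lambda>i j. monom (of_nat i * f j) (i + j))" using assms(1) by blast
  then show ?thesis using zinbiel_prelie_family[OF assms(2)] by simp
qed

lemma zinbiel_prelie_g1:
  fixes l a b :: "'k::field_char_0"
  assumes "N \<ge> 1" "b \<notin> {- of_nat n |n. n \<ge> 1}"
  shows "zinbiel_prelie_algebra smult (augmentation_ideal counit) half_prod (g1 N l a b)"
  unfolding g1_def
proof (rule zinbiel_prelie_family'[where f = "\<lambda>j. if j = 0 then l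
      else if N dvd j then a / (of_nat j / of_nat N + b) else 0"])
  fix j k :: nat assume jk: "j \<ge> 1" "k \<ge> 1"
  have nz: "of_nat n + b \<noteq> 0" if "n \<ge> 1" for n
    using assms(2) that by (auto simp: add_eq_0_iff2)
  show "(if j = 0 then l else if N dvd j then a / (of_nat j / of_nat N + b) else 0) *
        (if k = 0 then l else if N dvd k then a / (of_nat k / of_nat N + b) else 0) *
        (of_nat j - of_nat k) =
        (if j + k = 0 then l else if N dvd j + k then a / (of_nat (j + k) / of_nat N + b) else 0) *
        (of_nat j * (if k = 0 then l else if N dvd k then a / (of_nat k / of_nat N + b) else 0) -
         of_nat k * (if j = 0 then l else if N dvd j then a / (of_nat j / of_nat N + b) else 0))"
  proof (cases "N dvd j \<and> N dvd k")
    case True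
    then obtain m n where mn: "j = N * m" "k = N * n" by (auto elim!: dvdE)
    with jk have m1: "m \<ge> 1" "n \<ge> 1" by (auto intro: Suc_leI)
    have "of_nat (m + n) + b \<noteq> 0" using nz[of "m + n"] m1 by simp
    moreover have q: "of_nat j / of_nat N = (of_nat m :: 'k)" "of_nat k / of_nat N = (of_nat n :: 'k)"
       "of_nat (j + k) / of_nat N = (of_nat (m + n) :: 'k)"
      using assms(1) mn by (simp_all add: field_simps)
    moreover have "a / u * (a / v) * (c * x - c * y) = a / w * (c * x * (a / v) - c * y * (a / u))"
      if "u = x + b" "v = y + b" "w = x + y + b" "u \<noteq> 0" "v \<noteq> 0" "w \<noteq> 0" for u v w x y c :: 'k
    proof -
      have "a / w * (c * x * (a / v) - c * y * (a / u)) = a * a * c * (x * u - y * v) / (w * u * v)"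
        using that(4-6) by (simp add: field_simps)
      also have "x * u - y * v = (x - y) * w" unfolding that(1-3) by (simp add: algebra_simps)
      also have "a * a * c * ((x - y) * w) / (w * u * v) = a / u * (a / v) * (c * (x - y))"
        using that(6) by simp
      finally show ?thesis by (simp add: right_diff_distrib)
    qed
    ultimately show ?thesis using nz[OF m1(1)] nz[OF m1(2)] m1 assms(1) True jk
      unfolding q by (simp add: mn)
  next
    case False
    then show ?thesis using jk by (auto simp: dvd_add_left_iff dvd_add_right_iff)
  qed
qed (auto simp: mult_ac)

lemma zinbiel_prelie_g2:
  "zinbiel_prelie_algebra smult (augmentation_ideal counit) half_prod (g2 N l (\<mu> :: 'k::field_char_0))"
  unfolding g2_def
  by (rule zinbiel_prelie_family'[where f = "\<lambda>j. if j = 0 then l else if j = N then \<mu> else 0"]) auto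

lemma zinbiel_prelie_g3:
  "zinbiel_prelie_algebra smult (augmentation_ideal counit) half_prod (g3 N l (\<mu> :: 'k::field_char_0))"
  unfolding g3_def
  by (rule zinbiel_prelie_family'[where f = "\<lambda>j. if j = 0 then l else if N dvd j then \<mu> else 0"])
    (auto simp: algebra_simps dvd_add_left_iff dvd_add_right_iff)

lemma zinbiel_prelie_g4:
  "zinbiel_prelie_algebra smult (augmentation_ideal counit) half_prod (g4 (l :: 'k::field_char_0))"
  unfolding g4_def
  by (rule zinbiel_prelie_family'[where f = "\<lambda>j. if j = 0 then l else 0"]) auto


section \<open>Sweedler presentations of the reduced coproduct of \<open>K[X]\<close>\<close>

lemma comult_add: "comult (p + q) = comult p + comult q"
proof -
  have "map_poly (\<lambda>c. [:[:c:]:]) (p + q) = map_poly (\<lambda>c. [:[:c:]:]) p + map_poly (\<lambda>c. [:[:c:]:]) q"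
    by (auto intro!: poly_eqI simp: coeff_map_poly)
  then show ?thesis by (simp add: comult_def)
qed

lemma coeff_comult_monom:
  "coeff (coeff (comult (monom c n)) j) i = (if i + j = n then c * of_nat (n choose j) else 0)"
proof -
  have T: "[:0, 1 :: 'a:] \<otimes> 1 + 1 \<otimes> [:0, 1:] = [:[:0, 1:], 1:]"
    by (auto intro!: poly_eqI simp: tensor_def tensor_poly_def coeff_map_poly coeff_pCons split: nat.splits)
  have "comult (monom c n) = [:[:c:]:] * [:[:0, 1:], 1:] ^ n"
    by (simp add: comult_def T map_poly_monom poly_monom)
  also have "coeff (coeff \<dots> j) i = c * (of_nat (n choose j) * coeff (monom 1 (n - j)) i)"
  proof (cases "j \<le> n")
    case True
    then show ?thesis by (simp add: coeff_linear_poly_power of_nat_poly monom_altdef)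
  next
    case False
    have "degree ([:[:0, 1 :: 'a:], 1:] ^ n) \<le> n"
      using degree_power_le[of "[:[:0, 1 :: 'a:], 1:]" n] by simp
    with False show ?thesis by (simp add: coeff_eq_0 binomial_eq_0)
  qed
  also have "\<dots> = (if i + j = n then c * of_nat (n choose j) else 0)"
    by (cases "j \<le> n") (auto simp: binomial_eq_0)
  finally show ?thesis .
qed

lemma coeff_reduced_comult:
  assumes "p \<in> augmentation_ideal counit" "i = 0 \<or> j = 0"
  shows "coeff (coeff (reduced_coproduct 1 comult p) j) i = 0"
  using assms(1)
proof (induction p rule: augmentation_ideal_induct)
  case (monom c n)
  then show ?case using assms(2)
    by (auto simp: reduced_coproduct_def coeff_comult_monom tensor_def tensor_poly_def coeff_map_poly)
next
  case (add p q)
  have "(x + y) \<otimes> z = x \<otimes> z + y \<otimes> z" "z \<otimes> (x + y) = z \<otimes> x + z \<otimes> y" for x y z :: "'a poly"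
    by (auto intro!: poly_eqI simp: tensor_def tensor_poly_def coeff_map_poly algebra_simps)
  then have "reduced_coproduct 1 comult (p + q) = reduced_coproduct 1 comult p + reduced_coproduct 1 comult q"
    by (simp add: reduced_coproduct_def comult_add)
  with add show ?case by simp
qed

lemma sweedler_reduced_exists:
  "\<exists>s. sweedler (augmentation_ideal counit) (reduced_coproduct 1 comult) s"
proof -
  define R where "R = reduced_coproduct (1 :: 'a poly) comult"
  define s where "s p = map (\<lambda>j. (coeff (R p) j, monom (1 :: 'a) j)) [1..<Suc (degree (R p))]" for p
  have R0: "coeff (coeff (R p) j) i = 0" if "p \<in> augmentation_ideal counit" "i = 0 \<or> j = 0" for p i j
    unfolding R_def using coeff_reduced_comult that .
  have "sweedler (augmentation_ideal counit) R s"
    unfolding sweedler_def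
  proof (intro ballI conjI)
    fix p :: "'a poly" assume p: "p \<in> augmentation_ideal counit"
    show "set (s p) \<subseteq> augmentation_ideal counit \<times> augmentation_ideal counit"
      using R0[OF p]
      by (auto simp: s_def augmentation_ideal_def counit_def poly_0_coeff_0 simp del: upt_Suc)
    have m: "monom (coeff (R p) j) j = coeff (R p) j \<otimes> monom 1 j" for j
      by (auto intro!: poly_eqI simp: tensor_def tensor_poly_def coeff_map_poly)
    have "R p = (\<Sum>j\<le>degree (R p). monom (coeff (R p) j) j)" by (simp add: poly_as_sum_of_monoms)
    also have "\<dots> = (\<Sum>j\<in>{1..<Suc (degree (R p))}. monom (coeff (R p) j) j)"
      using R0[OF p] by (intro sum.mono_neutral_right) (auto simp: poly_eq_iff not_less_eq_eq le_Suc_eq)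
    also have "\<dots> = (\<Sum>(x, y)\<leftarrow>s p. x \<otimes> y)"
      using sum_set_upt_conv_sum_list_nat[of "\<lambda>j. coeff (R p) j \<otimes> monom 1 j" 1 "Suc (degree (R p))"]
      by (simp add: s_def o_def m del: upt_Suc)
    finally show "R p = (\<Sum>(x, y)\<leftarrow>s p. x \<otimes> y)" .
  qed
  then show ?thesis unfolding R_def by blast
qed

end

theory Submission
  imports Defs
begin

text \<open>
  Every product in the four families has the form \<open>X^i \<bullet> X^j = i f(j) X^(i+j)\<close>, so that
  \<open>a \<bullet> b = a' W(b)\<close>, where \<open>a'\<close> is the derivative and \<open>W(X^j) = f(j) X^(j+1)\<close>. Identify
  \<open>K[X] \<otimes> K[X]\<close> with the polynomials in two variables; the coproduct of \<open>p\<close> is then \<open>p(X + Y)\<close>,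
  it commutes with differentiation in either variable, and the compatibility of \<open>\<bullet>\<close> with the
  coproduct becomes
    \<open>a'(X+Y) W(b)(X+Y) = a'(X+Y) W(b)(Y) + a'(X+Y) (W \<otimes> id)(b(X+Y))\<close>.
  It holds exactly when \<open>W(b)(X+Y) = W(b)(Y) + (W \<otimes> id)(b(X+Y))\<close> for all \<open>b\<close>.

  Necessity. For \<open>b = X^n\<close>, comparing the coefficients of \<open>X Y^n\<close> gives \<open>(n+1) f(n) = f(0)\<close>
  (\<open>compatibility_forces_antideriv\<close>). Hence \<open>f\<close> vanishes nowhere or everywhere. This forces
  \<open>\<lambda> = 0\<close> in the fourth family, excludes the second, and in the first leaves \<open>N = 1\<close> and
  \<open>a (j+1) = \<lambda> (j+b)\<close> for \<open>j \<ge> 1\<close>, that is, \<open>\<lambda> = a\<close> and \<open>b = 1\<close>. The third is excluded because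
  its \<open>f\<close> takes the same nonzero value at \<open>N\<close> and \<open>2 N\<close>.

  Sufficiency. If \<open>f(n) = \<lambda> / (n+1)\<close>, then \<open>W\<close> is \<open>\<lambda>\<close> times integration from \<open>0\<close>, and the
  remaining equation says that the integral of \<open>b\<close> from \<open>0\<close> to \<open>X + Y\<close> is the integral from \<open>0\<close>
  to \<open>Y\<close> plus the integral of \<open>b(t + Y)\<close> for \<open>t\<close> from \<open>0\<close> to \<open>X\<close> (\<open>comult_antideriv\<close>). The pre-Lie
  identity is integration by parts, and the Leibniz rule is that of the derivative.

  The half-product is also an integral, \<open>a \<prec> b\<close> being the antiderivative of \<open>a' b\<close>. Its
  compatibility with the reduced coproduct therefore comes from the same splitting of an integral
  (\<open>comult_half_prod\<close>, \<open>reduced_comult_half_prod\<close>), so that the two bialgebra notions agree on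
  these families.
\<close>

section \<open>Sums of pure tensors\<close>

lemma coeff_tensor: "coeff (coeff (p \<otimes> q) j) i = coeff p i * coeff q j"
  by (simp add: tensor_def tensor_poly_def coeff_map_poly mult.commute)

lemma coeff_tensor3: "coeff (coeff (coeff (tensor3 p q r) k) j) i = coeff p i * coeff q j * coeff r k"
  by (simp add: tensor3_def tensor_poly_def coeff_map_poly coeff_tensor mult.commute)

lemma poly_poly_eqI: "(\<And>i j. coeff (coeff s j) i = coeff (coeff t j) i) \<Longrightarrow> s = t"
  by (simp add: poly_eq_iff)

lemma tensor_mult: "(p \<otimes> q) * (r \<otimes> s) = (p * r) \<otimes> (q * s)"
proof -
  have eq: "p \<otimes> q = smult p (map_poly (\<lambda>c. [:c:]) q)" for p q :: "'a poly"
    by (rule poly_poly_eqI) (simp add: coeff_tensor coeff_map_poly)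
  have C: "map_poly (\<lambda>c. [:c:]) (q * s) = map_poly (\<lambda>c. [:c:]) q * map_poly (\<lambda>c. [:c:]) s"
    for q s :: "'a poly"
  proof (rule poly_eqI)
    fix n
    have "[:\<Sum>i\<le>n. h i:] = (\<Sum>i\<le>n. [:h i:])" for h :: "nat \<Rightarrow> 'a"
      by (rule poly_eqI) (auto simp: coeff_sum coeff_pCons split: nat.split)
    then show "coeff (map_poly (\<lambda>c. [:c:]) (q * s)) n =
        coeff (map_poly (\<lambda>c. [:c:]) q * map_poly (\<lambda>c. [:c:]) s) n"
      by (simp add: coeff_map_poly coeff_mult mult.commute)
  qed
  show ?thesis
    by (simp add: eq C mult.commute)
qed

lemma coeff_sum_tensor:
  "coeff (coeff (\<Sum>(x, y)\<leftarrow>xs. x \<otimes> y) j) i = (\<Sum>(x, y)\<leftarrow>xs. coeff x i * coeff y j)"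
  by (induction xs) (auto simp: coeff_tensor)

lemma sum_list_times_sum_list:
  fixes t u :: "'a \<Rightarrow> 'b \<Rightarrow> 'c::semiring_0"
  shows "(\<Sum>(a1, a2)\<leftarrow>as. \<Sum>(b1, b2)\<leftarrow>bs. t a1 a2 * u b1 b2) =
    (\<Sum>(a1, a2)\<leftarrow>as. t a1 a2) * (\<Sum>(b1, b2)\<leftarrow>bs. u b1 b2)"
proof -
  have "(\<Sum>(b1, b2)\<leftarrow>bs. t a1 a2 * u b1 b2) = t a1 a2 * (\<Sum>(b1, b2)\<leftarrow>bs. u b1 b2)" for a1 a2
    by (induction bs) (auto simp: distrib_left)
  then show ?thesis
    by (induction as) (auto simp: distrib_right)
qed

lemma map_poly_linear_add:
  fixes h :: "'a::ab_group_add \<Rightarrow> 'b::ab_group_add"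
  assumes "\<And>p q. h (p + q) = h p + h q"
  shows "map_poly h (s + t) = map_poly h s + map_poly h t"
proof -
  have "h 0 = 0" using assms[of 0 0] by simp
  then show ?thesis by (auto intro!: poly_eqI simp: coeff_map_poly assms)
qed

text \<open>On polynomials with coefficients in \<open>K[X]\<close>, a linear map \<open>h\<close> acts on the left tensor factor
  by \<open>map_poly h\<close>, while derivation of the outer polynomial acts on the right factor. Both remove the
  choice of a presentation from sums in Sweedler's notation.\<close>

lemma map_poly_tensor:
  assumes "\<And>p q. h (p + q) = h p + h q" "\<And>c p. h (smult c p) = smult c (h p)"
  shows "map_poly h (p \<otimes> q) = h p \<otimes> q"
proof -
  have "h 0 = 0" using assms(2)[of 0 0] by simp
  then show ?thesis
    by (auto intro!: poly_eqI simp: tensor_def tensor_poly_def coeff_map_poly assms)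
qed

lemma sum_tensor_map_left:
  assumes "\<And>p q. h (p + q) = h p + h q" "\<And>c p. h (smult c p) = smult c (h p)"
  shows "(\<Sum>(x, y)\<leftarrow>xs. h x \<otimes> y) = map_poly h (\<Sum>(x, y)\<leftarrow>xs. x \<otimes> y)"
  by (induction xs) (auto simp: map_poly_linear_add assms(1) map_poly_tensor[OF assms])

lemma pderiv_tensor: "pderiv (p \<otimes> q) = p \<otimes> pderiv q"
  by (rule poly_poly_eqI)
    (simp add: coeff_pderiv coeff_tensor of_nat_poly flip: of_nat_Suc del: of_nat_Suc)

lemma sum_tensor_pderiv_right: "(\<Sum>(x, y)\<leftarrow>xs. x \<otimes> pderiv y) = pderiv (\<Sum>(x, y)\<leftarrow>xs. x \<otimes> y)"
  by (induction xs) (auto simp: pderiv_add pderiv_tensor)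

section \<open>The coproduct as substitution of a sum of variables\<close>

text \<open>The coefficients of \<open>p(X + Y)\<close>, by the binomial theorem. Through this formula, identities
  between coproducts reduce to identities between binomial coefficients.\<close>

lemma coeff_comult: "coeff (coeff (comult p) j) i = coeff p (i + j) * of_nat ((i + j) choose j)"
  by (induction p rule: monom_add_induct)
    (auto simp: coeff_comult_monom comult_add algebra_simps)

lemma comult_smult: "comult (smult c p) = smult [:c:] (comult p)"
  by (rule poly_poly_eqI) (simp add: coeff_comult)

lemma comult_X: "comult [:0, 1:] = [:0, 1:] \<otimes> 1 + 1 \<otimes> [:0, 1:]"
  by (rule poly_poly_eqI) (auto simp: coeff_comult coeff_tensor coeff_pCons split: nat.splits)

lemma comult_mult: "comult (p * q) = comult p * comult q"
proof -
  have m: "comult (monom c n) = [:[:c:]:] * ([:0, 1:] \<otimes> 1 + 1 \<otimes> [:0, 1:]) ^ n"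
    for c :: 'a and n
    by (simp add: comult_def map_poly_monom poly_monom)
  show ?thesis
  proof (induction p rule: monom_add_induct)
    case (1 c n)
    show ?case
    proof (induction q rule: monom_add_induct)
      case (1 d k)
      have "[:[:c * d:]:] = [:[:c:]:] * [:[:d:]:]" by simp
      then show ?case by (simp only: mult_monom m power_add mult_ac)
    qed (simp add: comult_add distrib_left)
  qed (simp add: comult_add distrib_right)
qed

text \<open>The two partial derivatives of \<open>p(X + Y)\<close> are both \<open>p'(X + Y)\<close>.\<close>

lemma pderiv_comult: "pderiv (comult p) = comult (pderiv p)"
proof (rule poly_poly_eqI)
  fix i j
  have "of_nat (Suc j) * of_nat ((i + Suc j) choose Suc j) =
      (of_nat (Suc (i + j)) * of_nat ((i + j) choose j) :: 'a)"
    using Suc_times_binomial_eq[of "i + j" j] unfolding of_nat_mult[symmetric]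
    by (simp only: mult.commute add_Suc_right)
  then show "coeff (coeff (pderiv (comult p)) j) i = coeff (coeff (comult (pderiv p)) j) i"
    by (simp add: coeff_pderiv coeff_comult of_nat_poly mult_ac flip: of_nat_Suc del: of_nat_Suc)
qed

lemma map_poly_pderiv_comult: "map_poly pderiv (comult p) = comult (pderiv p)"
proof (rule poly_poly_eqI)
  fix i j
  have "Suc i * (Suc (i + j) choose j) = Suc (i + j) * ((i + j) choose j)"
    using binomial_absorb_comp[of "Suc (i + j)" j] by (simp add: Suc_diff_le)
  then have "of_nat (Suc i) * of_nat (Suc (i + j) choose j) =
      (of_nat (Suc (i + j)) * of_nat ((i + j) choose j) :: 'a)"
    unfolding of_nat_mult[symmetric] by simp
  then show "coeff (coeff (map_poly pderiv (comult p)) j) i = coeff (coeff (comult (pderiv p)) j) i"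
    by (simp add: coeff_pderiv coeff_comult coeff_map_poly mult_ac flip: of_nat_Suc del: of_nat_Suc)
qed

section \<open>Antiderivatives\<close>

definition antideriv :: "'k::field poly \<Rightarrow> 'k poly" where
  "antideriv p = (\<Sum>i\<le>degree p. monom (coeff p i / of_nat (Suc i)) (Suc i))"

lemma coeff_antideriv: "coeff (antideriv p) n = (if n = 0 then 0 else coeff p (n - 1) / of_nat n)"
proof (cases n)
  case (Suc m)
  have "coeff (antideriv p) n = (\<Sum>i\<le>degree p. if i = m then coeff p i / of_nat (Suc i) else 0)"
    unfolding antideriv_def coeff_sum Suc by (rule sum.cong) auto
  then show ?thesis by (auto simp: Suc coeff_eq_0 simp del: of_nat_Suc)
qed (simp add: antideriv_def coeff_sum)

lemma antideriv_0 [simp]: "antideriv 0 = 0"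
  by (simp add: antideriv_def)

lemma antideriv_add: "antideriv (p + q) = antideriv p + antideriv q"
  by (rule poly_eqI) (simp add: coeff_antideriv add_divide_distrib)

lemma antideriv_smult: "antideriv (smult c p) = smult c (antideriv p)"
  by (rule poly_eqI) (simp add: coeff_antideriv)

lemma antideriv_monom: "antideriv (monom c n) = monom (c / of_nat (Suc n)) (Suc n)"
  by (rule poly_eqI) (auto simp: coeff_antideriv)

lemma pderiv_antideriv: "pderiv (antideriv p) = (p :: 'k::field_char_0 poly)"
  by (rule poly_eqI) (simp add: coeff_antideriv coeff_pderiv del: of_nat_Suc)

lemma antideriv_pderiv: "antideriv (pderiv p) = p - [:coeff (p :: 'k::field_char_0 poly) 0:]"
proof (rule poly_eqI)
  fix n show "coeff (antideriv (pderiv p)) n = coeff (p - [:coeff p 0:]) n"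
    by (cases n) (simp_all add: coeff_antideriv coeff_pderiv del: of_nat_Suc)
qed

text \<open>There is no boundary term, since \<open>antideriv c\<close> vanishes at \<open>0\<close>.\<close>

lemma antideriv_by_parts:
  fixes b c :: "'k::field_char_0 poly"
  shows "antideriv (pderiv b * antideriv c) = b * antideriv c - antideriv (b * c)"
proof -
  have "antideriv (pderiv (b * antideriv c)) = b * antideriv c"
    by (simp add: antideriv_pderiv coeff_mult coeff_antideriv)
  then show ?thesis
    by (simp add: pderiv_mult pderiv_antideriv antideriv_add algebra_simps)
qed

text \<open>The integral of \<open>p\<close> from \<open>0\<close> to \<open>X + Y\<close> splits at \<open>Y\<close>; in the part from \<open>Y\<close> to \<open>X + Y\<close> the
  substitution \<open>t \<mapsto> t + Y\<close> turns the integrand into \<open>p(t + Y)\<close>, integrated in the first variable.\<close>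

lemma comult_antideriv:
  "comult (antideriv p) = 1 \<otimes> antideriv p + map_poly antideriv (comult (p :: 'k::field_char_0 poly))"
proof (rule poly_poly_eqI)
  fix i j
  show "coeff (coeff (comult (antideriv p)) j) i =
      coeff (coeff (1 \<otimes> antideriv p + map_poly antideriv (comult p)) j) i"
  proof (cases i)
    case 0
    then show ?thesis by (simp add: coeff_comult coeff_tensor coeff_map_poly coeff_antideriv)
  next
    case (Suc k)
    have "Suc k * (Suc (k + j) choose j) = Suc (k + j) * ((k + j) choose j)"
      using binomial_absorb_comp[of "Suc (k + j)" j] by (simp add: Suc_diff_le)
    then have "of_nat (Suc k) * of_nat (Suc (k + j) choose j) =
        (of_nat (Suc (k + j)) * of_nat ((k + j) choose j) :: 'k)"
      unfolding of_nat_mult[symmetric] by simp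
    then have "of_nat (Suc (k + j) choose j) / of_nat (Suc (k + j)) =
        (of_nat ((k + j) choose j) / of_nat (Suc k) :: 'k)"
      by (simp add: frac_eq_eq mult.commute del: of_nat_Suc)
    then have "coeff p (k + j) * (of_nat (Suc (k + j) choose j) / of_nat (Suc (k + j))) =
        coeff p (k + j) * (of_nat ((k + j) choose j) / of_nat (Suc k))"
      by (rule arg_cong)
    then show ?thesis
      using Suc by (simp add: coeff_comult coeff_tensor coeff_map_poly coeff_antideriv del: of_nat_Suc)
  qed
qed

section \<open>The bialgebra \<open>K[X]\<close>\<close>

text \<open>Coassociativity holds because both sides are \<open>a(X + Y + Z)\<close>; comparing coefficients, it is the
  equality of two expressions for a trinomial coefficient.\<close>

lemma bialgebra_poly: "bialgebra (*) (1 :: 'k::field poly) comult counit"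
  unfolding bialgebra_def
proof (intro conjI allI impI)
  show "bilinear_on smult UNIV ((*) :: 'k poly \<Rightarrow> _)"
    by (simp add: bilinear_on_def algebra_simps)
  show "Vector_Spaces.linear smult scale2 (comult :: 'k poly \<Rightarrow> _)"
    unfolding Vector_Spaces.linear_iff
    by (simp add: vector_space_smult vector_space_scale2 comult_add comult_smult)
  have "vector_space ((*) :: 'k \<Rightarrow> _)" by unfold_locales (simp_all add: algebra_simps)
  then show "Vector_Spaces.linear smult (*) (counit :: 'k poly \<Rightarrow> _)"
    unfolding Vector_Spaces.linear_iff by (simp add: vector_space_smult counit_def)
  show "comult (1 :: 'k poly) = 1 \<otimes> 1"
    by (rule poly_poly_eqI) (simp add: coeff_comult coeff_tensor)
next
  fix s :: "'k poly \<Rightarrow> ('k poly \<times> 'k poly) list" and a b :: "'k poly"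
  assume s: "sweedler UNIV comult s"
  then have D: "comult a = (\<Sum>(x, y)\<leftarrow>s a. x \<otimes> y)" for a
    by (simp add: sweedler_def)
  have c: "(\<Sum>(x, y)\<leftarrow>s a. coeff x i * coeff y j) = coeff a (i + j) * of_nat ((i + j) choose j)"
    for a i j
    by (simp only: flip: coeff_sum_tensor D coeff_comult)
  show "(\<Sum>(a1, a2)\<leftarrow>s a. \<Sum>(x, y)\<leftarrow>s a1. tensor3 x y a2) =
      (\<Sum>(a1, a2)\<leftarrow>s a. \<Sum>(x, y)\<leftarrow>s a2. tensor3 a1 x y)" (is "?L = ?R")
  proof -
    have cL: "coeff (coeff (coeff (\<Sum>(x, y)\<leftarrow>xs. tensor3 x y r) k) j) i =
        (\<Sum>(x, y)\<leftarrow>xs. coeff x i * coeff y j) * coeff r k" for xs and r :: "'k poly" and i j k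
      by (induction xs) (auto simp: coeff_tensor3 distrib_right)
    have cR: "coeff (coeff (coeff (\<Sum>(x, y)\<leftarrow>xs. tensor3 r x y) k) j) i =
        coeff r i * (\<Sum>(x, y)\<leftarrow>xs. coeff x j * coeff y k)" for xs and r :: "'k poly" and i j k
      by (induction xs) (auto simp: coeff_tensor3 distrib_left mult.assoc)
    \<comment> \<open>Collapsing the inner sum leaves a sum over \<open>s a\<close> alone, and the formula \<open>c\<close> applies again.\<close>
    have L: "coeff (coeff (coeff ?L k) j) i =
        of_nat ((i + j) choose j) * (coeff a (i + j + k) * of_nat ((i + j + k) choose k))" for i j k
    proof -
      have "coeff (coeff (coeff (\<Sum>(a1, a2)\<leftarrow>xs. \<Sum>(x, y)\<leftarrow>s a1. tensor3 x y a2) k) j) i =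
          of_nat ((i + j) choose j) * (\<Sum>(x, y)\<leftarrow>xs. coeff x (i + j) * coeff y k)" for xs
        by (induction xs) (auto simp: cL c algebra_simps)
      then show ?thesis by (simp only: c)
    qed
    have R: "coeff (coeff (coeff ?R k) j) i =
        of_nat ((j + k) choose k) * (coeff a (i + (j + k)) * of_nat ((i + (j + k)) choose (j + k)))"
      for i j k
    proof -
      have "coeff (coeff (coeff (\<Sum>(a1, a2)\<leftarrow>xs. \<Sum>(x, y)\<leftarrow>s a2. tensor3 a1 x y) k) j) i =
          of_nat ((j + k) choose k) * (\<Sum>(x, y)\<leftarrow>xs. coeff x i * coeff y (j + k))" for xs
        by (induction xs) (auto simp: cR c algebra_simps)
      then show ?thesis by (simp only: c)
    qed
    have bin: "((i + j) choose j) * ((i + j + k) choose k) =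
        ((j + k) choose k) * ((i + (j + k)) choose (j + k))" for i j k
      using choose_mult[of k "j + k" "i + j + k"] by (simp add: ac_simps)
    show ?thesis
    proof (intro poly_eqI)
      fix i j k
      have "of_nat ((i + j) choose j) * (of_nat ((i + j + k) choose k)) =
        (of_nat ((j + k) choose k) * of_nat ((i + (j + k)) choose (j + k)) :: 'k)"
        using bin[of i j k] by (simp only: flip: of_nat_mult)
      then show "coeff (coeff (coeff ?L k) j) i = coeff (coeff (coeff ?R k) j) i"
        unfolding L R by (simp only: mult.left_commute[of _ "coeff _ _"] add.assoc)
    qed
  qed
  show "(\<Sum>(a1, a2)\<leftarrow>s a. smult (counit a1) a2) = a"
  proof (rule poly_eqI)
    fix n
    have "coeff (\<Sum>(a1, a2)\<leftarrow>xs. smult (counit a1) a2) n =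
        (\<Sum>(x, y)\<leftarrow>xs. coeff x 0 * coeff y n)" for xs :: "('k poly \<times> 'k poly) list"
      by (induction xs) (auto simp: counit_def poly_0_coeff_0)
    then show "coeff (\<Sum>(a1, a2)\<leftarrow>s a. smult (counit a1) a2) n = coeff a n"
      by (simp add: c)
  qed
  show "(\<Sum>(a1, a2)\<leftarrow>s a. smult (counit a2) a1) = a"
  proof (rule poly_eqI)
    fix n
    have "coeff (\<Sum>(a1, a2)\<leftarrow>xs. smult (counit a2) a1) n =
        (\<Sum>(x, y)\<leftarrow>xs. coeff x n * coeff y 0)" for xs :: "('k poly \<times> 'k poly) list"
      by (induction xs) (auto simp: counit_def poly_0_coeff_0)
    then show "coeff (\<Sum>(a1, a2)\<leftarrow>s a. smult (counit a2) a1) n = coeff a n"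
      by (simp add: c)
  qed
  show "comult (a * b) = (\<Sum>(a1, a2)\<leftarrow>s a. \<Sum>(b1, b2)\<leftarrow>s b. (a1 * b1) \<otimes> (a2 * b2))"
    by (simp only: comult_mult sum_list_times_sum_list flip: tensor_mult D)
qed (simp_all add: counit_def algebra_simps)

section \<open>The structures that satisfy the compatibility\<close>

definition integral_bullet :: "'k::field \<Rightarrow> 'k poly \<Rightarrow> 'k poly \<Rightarrow> 'k poly" where
  "integral_bullet l a b = pderiv a * smult l (antideriv b)"

text \<open>By parts, \<open>(a \<bullet> b) \<bullet> c - a \<bullet> (b \<bullet> c)\<close> equals \<open>l^2 (a'' B C + a' D)\<close>, with \<open>B\<close>, \<open>C\<close>, \<open>D\<close> the
  antiderivatives of \<open>b\<close>, \<open>c\<close> and \<open>b c\<close>. This is symmetric in \<open>b\<close> and \<open>c\<close>.\<close>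

lemma com_prelie_algebra_integral_bullet:
  "com_prelie_algebra smult (*) (integral_bullet (l :: 'k::field_char_0))"
  unfolding com_prelie_algebra_def
proof (intro conjI allI)
  show "bilinear_on smult UNIV ((*) :: 'k poly \<Rightarrow> _)"
    by (simp add: bilinear_on_def algebra_simps)
  show "bilinear_on smult UNIV (integral_bullet l)"
    by (simp add: bilinear_on_def integral_bullet_def pderiv_add pderiv_smult antideriv_add
      antideriv_smult smult_add_right distrib_left distrib_right mult.commute)
  show "prelie_on UNIV (integral_bullet l)"
    unfolding prelie_on_def
  proof (intro ballI)
    fix a b c :: "'k poly"
    have "integral_bullet l (integral_bullet l a b) c - integral_bullet l a (integral_bullet l b c) =
        smult (l * l) (pderiv (pderiv a) * antideriv b * antideriv c + pderiv a * antideriv (b * c))"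
      for b c
      by (simp add: integral_bullet_def pderiv_mult pderiv_smult pderiv_antideriv antideriv_smult
        antideriv_by_parts algebra_simps smult_add_right smult_diff_right)
    then show "integral_bullet l (integral_bullet l a b) c - integral_bullet l a (integral_bullet l b c) =
        integral_bullet l (integral_bullet l a c) b - integral_bullet l a (integral_bullet l c b)"
      by (simp add: mult_ac)
  qed
  show "integral_bullet l (a * b) c = integral_bullet l a c * b + a * integral_bullet l b c" for a b c
    by (simp add: integral_bullet_def pderiv_mult algebra_simps smult_add_right)
qed (simp_all add: vector_space_smult mult_ac)

text \<open>All three terms of the compatibility contain the factor \<open>a'(X + Y)\<close>. What remains when
  it is taken out is \<open>comult_antideriv\<close>, multiplied by \<open>l\<close>.\<close>

lemma com_prelie_bialgebra_integral_bullet: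
  "is_com_prelie_bialgebra (integral_bullet (l :: 'k::field_char_0))"
  unfolding com_prelie_bialgebra_def
proof (intro conjI allI impI com_prelie_algebra_integral_bullet bialgebra_poly)
  fix s :: "'k poly \<Rightarrow> ('k poly \<times> 'k poly) list" and a b :: "'k poly"
  assume s: "sweedler UNIV comult s"
  then have D: "comult a = (\<Sum>(x, y)\<leftarrow>s a. x \<otimes> y)" for a
    by (simp add: sweedler_def)
  define I where "I p = smult l (antideriv p)" for p
  have I: "I (p + q) = I p + I q" "I (smult c p) = smult c (I p)" for p q c
    by (simp_all add: I_def antideriv_add antideriv_smult smult_add_right mult.commute)
  have Dmap: "map_poly I (comult b) = smult [:l:] (map_poly antideriv (comult b))"
    by (rule poly_poly_eqI) (simp add: I_def coeff_map_poly)
  have DI: "comult (I b) = 1 \<otimes> I b + map_poly I (comult b)"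
  proof -
    have "smult [:l:] (1 \<otimes> antideriv b) = 1 \<otimes> I b"
      by (rule poly_poly_eqI) (simp add: I_def coeff_tensor)
    then show ?thesis
      by (simp add: Dmap I_def comult_smult comult_antideriv smult_add_right)
  qed
  have "(\<Sum>(a1, a2)\<leftarrow>s a. a1 \<otimes> integral_bullet l a2 b) =
      (\<Sum>(a1, a2)\<leftarrow>s a. a1 \<otimes> pderiv a2) * (1 \<otimes> I b)"
  proof -
    have "a1 \<otimes> integral_bullet l a2 b = (a1 \<otimes> pderiv a2) * (1 \<otimes> I b)" for a1 a2
      by (simp add: tensor_mult integral_bullet_def I_def)
    then show ?thesis by (simp add: sum_list_mult_const case_prod_unfold)
  qed
  also have "\<dots> = comult (pderiv a) * (1 \<otimes> I b)"
    by (simp add: sum_tensor_pderiv_right pderiv_comult flip: D)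
  finally have 1: "(\<Sum>(a1, a2)\<leftarrow>s a. a1 \<otimes> integral_bullet l a2 b) = comult (pderiv a) * (1 \<otimes> I b)" .
  have "(\<Sum>(a1, a2)\<leftarrow>s a. \<Sum>(b1, b2)\<leftarrow>s b. integral_bullet l a1 b1 \<otimes> (a2 * b2)) =
      (\<Sum>(a1, a2)\<leftarrow>s a. \<Sum>(b1, b2)\<leftarrow>s b. (pderiv a1 \<otimes> a2) * (I b1 \<otimes> b2))"
    by (simp add: integral_bullet_def I_def tensor_mult)
  also have "\<dots> = map_poly pderiv (comult a) * map_poly I (comult b)"
    unfolding sum_list_times_sum_list D
    by (subst (1 2) sum_tensor_map_left) (simp_all add: pderiv_add pderiv_smult I)
  finally have 2: "(\<Sum>(a1, a2)\<leftarrow>s a. \<Sum>(b1, b2)\<leftarrow>s b. integral_bullet l a1 b1 \<otimes> (a2 * b2)) =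
      comult (pderiv a) * map_poly I (comult b)"
    by (simp add: map_poly_pderiv_comult)
  have "comult (integral_bullet l a b) = comult (pderiv a) * comult (I b)"
    unfolding integral_bullet_def I_def by (rule comult_mult)
  then show "comult (integral_bullet l a b) =
      (\<Sum>(a1, a2)\<leftarrow>s a. a1 \<otimes> integral_bullet l a2 b) +
      (\<Sum>(a1, a2)\<leftarrow>s a. \<Sum>(b1, b2)\<leftarrow>s b. integral_bullet l a1 b1 \<otimes> (a2 * b2))"
    unfolding 1 2 DI by (simp only: distrib_left)
qed

section \<open>The half-product\<close>

text \<open>The formula also covers factors outside the augmentation ideal, where it gives
  \<open>1 \<prec> b = 0\<close> (for \<open>b = 1\<close> by the convention on division by zero) and \<open>a \<prec> 1 = a - a(0)\<close>.\<close>

lemma half_prod_conv_antideriv: "half_prod a b = antideriv (pderiv a * (b :: 'k::field_char_0 poly))"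
proof (induction a rule: monom_add_induct)
  case (1 c i)
  show ?case
  proof (induction b rule: monom_add_induct)
    case (1 d j)
    show ?case
      by (cases i) (simp_all add: half_prod_def bilinear_extension_simps pderiv_monom mult_monom
        antideriv_monom smult_monom mult_ac add_ac)
  next
    case (2 p q)
    then show ?case by (simp add: half_prod_def bilinear_extension_simps distrib_left antideriv_add)
  qed
next
  case (2 p q)
  then show ?case
    by (simp add: half_prod_def bilinear_extension_simps distrib_right pderiv_add antideriv_add)
qed

lemma half_prod_symmetrised:
  assumes "x \<in> augmentation_ideal counit"
  shows "half_prod x y + half_prod y x = x * (y :: 'k::field_char_0 poly)"
proof -
  have "coeff x 0 = 0"
    using assms by (simp add: augmentation_ideal_def counit_def poly_0_coeff_0)
  then have "antideriv (pderiv (x * y)) = x * y"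
    by (simp add: antideriv_pderiv coeff_mult)
  then show ?thesis
    by (simp add: half_prod_conv_antideriv pderiv_mult mult.commute flip: antideriv_add)
      (simp add: add.commute mult.commute)
qed

text \<open>The instance of \<open>comult_antideriv\<close> at \<open>p = a' b\<close>. Stated for the full coproduct and the
  extended half-product, the compatibility has only two terms.\<close>

lemma comult_half_prod:
  fixes a b :: "'k::field_char_0 poly"
  assumes "comult a = (\<Sum>(x, y)\<leftarrow>as. x \<otimes> y)" "comult b = (\<Sum>(x, y)\<leftarrow>bs. x \<otimes> y)"
  shows "comult (half_prod a b) = 1 \<otimes> half_prod a b +
    (\<Sum>(a1, a2)\<leftarrow>as. \<Sum>(b1, b2)\<leftarrow>bs. half_prod a1 b1 \<otimes> (a2 * b2))"
proof -
  note lin = antideriv_add antideriv_smult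
  have "(\<Sum>(b1, b2)\<leftarrow>bs. half_prod a1 b1 \<otimes> (a2 * b2)) =
      map_poly antideriv (\<Sum>(b1, b2)\<leftarrow>bs. (pderiv a1 * b1) \<otimes> (a2 * b2))" for a1 a2
    by (induction bs)
      (auto simp: map_poly_linear_add lin map_poly_tensor half_prod_conv_antideriv)
  then have "(\<Sum>(a1, a2)\<leftarrow>as. \<Sum>(b1, b2)\<leftarrow>bs. half_prod a1 b1 \<otimes> (a2 * b2)) =
      map_poly antideriv (\<Sum>(a1, a2)\<leftarrow>as. \<Sum>(b1, b2)\<leftarrow>bs. (pderiv a1 * b1) \<otimes> (a2 * b2))"
    by (induction as) (auto simp: map_poly_linear_add lin)
  also have "(\<Sum>(a1, a2)\<leftarrow>as. \<Sum>(b1, b2)\<leftarrow>bs. (pderiv a1 * b1) \<otimes> (a2 * b2)) =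
      (\<Sum>(a1, a2)\<leftarrow>as. pderiv a1 \<otimes> a2) * comult b"
    by (simp only: assms(2) sum_list_times_sum_list flip: tensor_mult)
  also have "(\<Sum>(a1, a2)\<leftarrow>as. pderiv a1 \<otimes> a2) = comult (pderiv a)"
    unfolding map_poly_pderiv_comult[symmetric] assms(1)
    by (rule sum_tensor_map_left) (simp_all add: pderiv_add pderiv_smult)
  finally show ?thesis
    by (simp add: half_prod_conv_antideriv comult_antideriv comult_mult)
qed

text \<open>Adding \<open>p \<otimes> 1\<close> and \<open>1 \<otimes> p\<close> to a presentation of the reduced coproduct of \<open>p\<close> gives one of the
  full coproduct. Expanding \<open>comult_half_prod\<close> for these presentations, the products with \<open>1\<close> on the
  left vanish, those with \<open>1\<close> on the right return their left factor, and \<open>(a \<prec> b) \<otimes> 1\<close> is cancelled in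
  passing to the reduced coproduct.\<close>

lemma reduced_comult_half_prod:
  fixes s :: "'k::field_char_0 poly \<Rightarrow> ('k poly \<times> 'k poly) list"
  defines "A \<equiv> augmentation_ideal counit"
  assumes s: "sweedler A (reduced_coproduct 1 comult) s" and a: "a \<in> A" and b: "b \<in> A"
  shows "reduced_coproduct 1 comult (half_prod a b) =
    (\<Sum>(a1, a2)\<leftarrow>s a. \<Sum>(b1, b2)\<leftarrow>s b. half_prod a1 b1 \<otimes> (a2 * b2)) +
    (\<Sum>(a1, a2)\<leftarrow>s a. half_prod a1 b \<otimes> a2) +
    (\<Sum>(a1, a2)\<leftarrow>s a. a1 \<otimes> (a2 * b)) +
    (\<Sum>(b1, b2)\<leftarrow>s b. half_prod a b1 \<otimes> b2) + a \<otimes> b"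
proof -
  have D: "comult p = (\<Sum>(x, y)\<leftarrow>(p, 1) # (1, p) # s p. x \<otimes> y)" if "p \<in> A" for p
    using s that by (auto simp: sweedler_def reduced_coproduct_def algebra_simps)
  have one: "half_prod 1 p = 0" for p :: "'k poly"
    by (simp add: half_prod_conv_antideriv antideriv_def)
  have right_one: "half_prod p 1 = p" if "p \<in> A" for p
    using that by (simp add: half_prod_conv_antideriv antideriv_pderiv A_def augmentation_ideal_def
      counit_def poly_0_coeff_0)
  have t0: "0 \<otimes> p = 0" for p :: "'k poly"
    by (rule poly_poly_eqI) (simp add: coeff_tensor)
  have r: "(\<Sum>(a1, a2)\<leftarrow>s a. half_prod a1 1 \<otimes> (a2 * b)) = (\<Sum>(a1, a2)\<leftarrow>s a. a1 \<otimes> (a2 * b))"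
  proof -
    have "set (s a) \<subseteq> A \<times> A" using s a by (simp add: sweedler_def)
    then show ?thesis
      by (intro arg_cong[where f = sum_list] map_cong refl) (auto simp: right_one)
  qed
  have "comult (half_prod a b) = 1 \<otimes> half_prod a b +
    (\<Sum>(a1, a2)\<leftarrow>(a, 1) # (1, a) # s a. \<Sum>(b1, b2)\<leftarrow>(b, 1) # (1, b) # s b. half_prod a1 b1 \<otimes> (a2 * b2))"
    by (rule comult_half_prod[OF D[OF a] D[OF b]])
  also have "(\<Sum>(a1, a2)\<leftarrow>(a, 1) # (1, a) # s a. \<Sum>(b1, b2)\<leftarrow>(b, 1) # (1, b) # s b. half_prod a1 b1 \<otimes> (a2 * b2)) =
      half_prod a b \<otimes> 1 + a \<otimes> b + (\<Sum>(b1, b2)\<leftarrow>s b. half_prod a b1 \<otimes> b2) +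
      ((\<Sum>(a1, a2)\<leftarrow>s a. half_prod a1 b \<otimes> a2) + (\<Sum>(a1, a2)\<leftarrow>s a. half_prod a1 1 \<otimes> (a2 * b)) +
       (\<Sum>(a1, a2)\<leftarrow>s a. \<Sum>(b1, b2)\<leftarrow>s b. half_prod a1 b1 \<otimes> (a2 * b2)))"
    by (simp add: one t0 right_one[OF a] case_prod_unfold sum_list_addf add.assoc)
  finally show ?thesis
    unfolding r reduced_coproduct_def by (simp add: algebra_simps)
qed

lemma zinbiel_prelie_bialgebra_integral_bullet:
  fixes l :: "'k::field_char_0"
  assumes "zinbiel_prelie_algebra smult (augmentation_ideal counit) half_prod (integral_bullet l)"
  shows "is_zinbiel_prelie_bialgebra (integral_bullet l)"
  unfolding zinbiel_prelie_bialgebra_def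
  by (intro conjI ballI allI impI com_prelie_bialgebra_integral_bullet assms half_prod_symmetrised
      reduced_comult_half_prod)

section \<open>A necessary condition\<close>

text \<open>The compatibility at \<open>X\<close> and \<open>X^n\<close> says that the coproduct of \<open>f(n) X^(n+1)\<close> is
  \<open>1 \<otimes> f(n) X^(n+1)\<close> plus the sum of \<open>binom(n, k) f(k) X^(k+1) \<otimes> X^(n-k)\<close>. The term \<open>X \<otimes> X^n\<close> has
  coefficient \<open>(n+1) f(n)\<close> on the left and \<open>f(0)\<close> on the right.\<close>

lemma compatibility_forces_antideriv:
  fixes f :: "nat \<Rightarrow> 'k::field"
  assumes bialg: "is_com_prelie_bialgebra (bilinear_extension F)"
    and F: "\<And>i j. F i j = monom (of_nat i * f j) (i + j)"
  shows "of_nat (Suc n) * f n = f 0"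
proof -
  define B where "B = bilinear_extension F"
  define X where "X = monom (1 :: 'k) 1"
  have X: "X = [:0, 1:]" by (simp add: X_def monom_altdef)
  have B1: "B 1 p = 0" for p
  proof (induction p rule: monom_add_induct)
    case (1 c n)
    show ?case using bilinear_extension_monom[of F 1 0 c n] by (simp add: B_def F)
  qed (simp add: B_def bilinear_extension_simps)
  have BX: "coeff (B X p) (Suc i) = f i * coeff p i" for p i
    by (induction p rule: monom_add_induct)
      (auto simp: X_def B_def bilinear_extension_simps F smult_monom distrib_left)
  have t0: "p \<otimes> 0 = 0" "0 \<otimes> p = 0" for p :: "'k poly"
    by (rule poly_poly_eqI; simp add: coeff_tensor)+
  obtain s0 where s0: "sweedler UNIV (comult :: 'k poly \<Rightarrow> _) s0"
    using sweedler_exists by blast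
  \<comment> \<open>The compatibility holds for every choice of presentations, so the obvious one of the coproduct
    of \<open>X\<close> may be used. That of \<open>X^n\<close> stays arbitrary: for \<open>n = 1\<close> it is the same one.\<close>
  define s where "s = s0(X := [(X, 1), (1, X)])"
  have s: "sweedler UNIV comult s"
    unfolding sweedler_def
  proof (intro ballI conjI)
    fix a show "comult a = (\<Sum>(x, y)\<leftarrow>s a. x \<otimes> y)"
    proof (cases "a = X")
      case True
      then show ?thesis by (simp add: s_def X comult_X)
    next
      case False
      then show ?thesis using s0 by (simp add: s_def sweedler_def)
    qed
  qed simp
  define p where "p = monom (1 :: 'k) n"
  have "comult (B X p) = (\<Sum>(a1, a2)\<leftarrow>s X. a1 \<otimes> B a2 p) +
      (\<Sum>(a1, a2)\<leftarrow>s X. \<Sum>(b1, b2)\<leftarrow>s p. B a1 b1 \<otimes> (a2 * b2))"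
    using bialg s unfolding com_prelie_bialgebra_def B_def by blast
  also have "\<dots> = 1 \<otimes> B X p + (\<Sum>(b1, b2)\<leftarrow>s p. B X b1 \<otimes> b2)"
    by (simp add: s_def B1 t0 case_prod_unfold)
  finally have eq: "comult (B X p) = 1 \<otimes> B X p + (\<Sum>(b1, b2)\<leftarrow>s p. B X b1 \<otimes> b2)" .
  have sum: "coeff (coeff (\<Sum>(b1, b2)\<leftarrow>xs. B X b1 \<otimes> b2) n) 1 =
      f 0 * (\<Sum>(x, y)\<leftarrow>xs. coeff x 0 * coeff y n)" for xs
    using BX[of _ 0] by (induction xs) (auto simp: coeff_tensor algebra_simps)
  have "(\<Sum>(x, y)\<leftarrow>s p. coeff x 0 * coeff y n) = coeff (coeff (comult p) n) 0"
    using s by (simp add: coeff_sum_tensor sweedler_def)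
  also have "\<dots> = 1" by (simp add: coeff_comult p_def)
  finally have "coeff (coeff (comult (B X p)) n) 1 = f 0"
    unfolding eq coeff_add sum by (simp add: coeff_tensor)
  moreover have "coeff (coeff (comult (B X p)) n) 1 = f n * of_nat (Suc n)"
    using BX[of p n] by (simp add: coeff_comult p_def)
  ultimately show ?thesis by (simp add: mult.commute)
qed

section \<open>The four families\<close>

lemma integral_bullet_conv_bilinear_extension:
  fixes l :: "'k::field_char_0"
  assumes F: "\<And>i j. F i j = monom (of_nat i * (l / of_nat (Suc j))) (i + j)"
  shows "bilinear_extension F = integral_bullet l"
proof (intro ext)
  fix a b
  show "bilinear_extension F a b = integral_bullet l a b"
  proof (induction a rule: monom_add_induct)
    case (1 c i)
    show ?case
    proof (induction b rule: monom_add_induct)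
      case (1 d j)
      show ?case
        by (cases i) (simp_all add: integral_bullet_def bilinear_extension_simps F pderiv_monom
          mult_monom antideriv_monom smult_monom mult_ac del: of_nat_Suc)
    next
      case (2 p q)
      then show ?case
        by (simp add: integral_bullet_def bilinear_extension_simps antideriv_add smult_add_right distrib_left)
    qed
  next
    case (2 p q)
    then show ?case
      by (simp add: integral_bullet_def bilinear_extension_simps pderiv_add smult_add_right distrib_right)
  qed
qed

lemma g1_conv_integral_bullet: "g1 1 a a 1 = integral_bullet (a :: 'k::field_char_0)"
  unfolding g1_def
  by (rule integral_bullet_conv_bilinear_extension) (auto simp: mult_ac add.commute)

lemma g4_conv_integral_bullet: "g4 0 = integral_bullet (0 :: 'k::field_char_0)"
  unfolding g4_def
  by (rule integral_bullet_conv_bilinear_extension) auto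

lemma g1_com_prelie_bialgebraD:
  fixes l a b :: "'k::field_char_0"
  assumes "is_com_prelie_bialgebra (g1 N l a b)" "N \<ge> 1" "a \<noteq> 0" "b \<notin> {- of_nat n |n. n \<ge> 1}"
  shows "N = 1 \<and> l = a \<and> b = 1"
proof -
  define f where "f j = (if j = 0 then l else if N dvd j then a / (of_nat j / of_nat N + b) else 0)" for j
  have f: "of_nat (Suc n) * f n = f 0" for n
    by (rule compatibility_forces_antideriv[OF assms(1)[unfolded g1_def]]) (auto simp: f_def mult_ac)
  have nz: "of_nat n + b \<noteq> 0" if "n \<ge> 1" for n
    using assms(4) that by (auto simp: add_eq_0_iff2)
  \<comment> \<open>One nonzero value of \<open>f\<close> makes \<open>f 0\<close>, hence every value, nonzero, so \<open>N\<close> divides \<open>1\<close>.\<close>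
  have "f N \<noteq> 0" using assms nz[of 1] by (simp add: f_def)
  then have "l \<noteq> 0" using f[of N] assms(2) by (auto simp: f_def simp del: of_nat_Suc)
  then have N: "N = 1" using f[of 1] by (auto simp: f_def split: if_splits)
  have "2 * a = l * (1 + b)" "3 * a = l * (2 + b)"
    using f[of 1] f[of 2] nz[of 1] nz[of 2] by (simp_all add: f_def N field_simps)
  moreover from this have "l = a" by algebra
  ultimately show ?thesis using N assms(3) by (simp add: algebra_simps)
qed

lemma g2_not_com_prelie_bialgebra:
  fixes l \<mu> :: "'k::field_char_0"
  assumes "N \<ge> 1" "\<mu> \<noteq> 0"
  shows "\<not> is_com_prelie_bialgebra (g2 N l \<mu>)"
proof
  assume bialg: "is_com_prelie_bialgebra (g2 N l \<mu>)"
  define f where "f j = (if j = 0 then l else if j = N then \<mu> else 0)" for j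
  have f: "of_nat (Suc n) * f n = f 0" for n
    by (rule compatibility_forces_antideriv[OF bialg[unfolded g2_def]]) (auto simp: f_def)
  have "f 0 = 0" using f[of "Suc N"] by (simp add: f_def)
  then show False using f[of N] assms by (simp add: f_def del: of_nat_Suc)
qed

lemma g3_not_com_prelie_bialgebra:
  fixes l \<mu> :: "'k::field_char_0"
  assumes "N \<ge> 1" "\<mu> \<noteq> 0"
  shows "\<not> is_com_prelie_bialgebra (g3 N l \<mu>)"
proof
  assume bialg: "is_com_prelie_bialgebra (g3 N l \<mu>)"
  define f where "f j = (if j = 0 then l else if N dvd j then \<mu> else 0)" for j
  have f: "of_nat (Suc n) * f n = f 0" for n
    by (rule compatibility_forces_antideriv[OF bialg[unfolded g3_def]]) (auto simp: f_def)
  have "of_nat (Suc N) * \<mu> = of_nat (Suc (2 * N)) * \<mu>"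
    using f[of N] f[of "2 * N"] assms(1) by (simp add: f_def del: of_nat_Suc)
  then show False using assms by (simp del: of_nat_Suc)
qed

lemma g4_com_prelie_bialgebraD:
  fixes l :: "'k::field_char_0"
  assumes "is_com_prelie_bialgebra (g4 l)"
  shows "l = 0"
  using compatibility_forces_antideriv[OF assms[unfolded g4_def], of "\<lambda>j. if j = 0 then l else 0" 1]
  by auto

section \<open>Classification\<close>

theorem proposition3p4:
  shows
    "(\<forall>N (l :: 'k::field_char_0) a b. N \<ge> 1 \<and> a \<noteq> 0 \<and> b \<notin> {- of_nat n |n. n \<ge> 1} \<longrightarrow>
        (is_com_prelie_bialgebra (g1 N l a b) \<longleftrightarrow> N = 1 \<and> l = a \<and> b = 1) \<and>
        (is_zinbiel_prelie_bialgebra (g1 N l a b) \<longleftrightarrow> N = 1 \<and> l = a \<and> b = 1)) \<and>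
     (\<forall>N (l :: 'k) \<mu>. N \<ge> 1 \<and> \<mu> \<noteq> 0 \<longrightarrow>
        \<not> is_com_prelie_bialgebra (g2 N l \<mu>) \<and> \<not> is_zinbiel_prelie_bialgebra (g2 N l \<mu>) \<and>
        \<not> is_com_prelie_bialgebra (g3 N l \<mu>) \<and> \<not> is_zinbiel_prelie_bialgebra (g3 N l \<mu>)) \<and>
     (\<forall>l :: 'k.
        (is_com_prelie_bialgebra (g4 l) \<longleftrightarrow> l = 0) \<and>
        (is_zinbiel_prelie_bialgebra (g4 l) \<longleftrightarrow> l = 0))"
proof -
  have com: "is_com_prelie_bialgebra B" if "is_zinbiel_prelie_bialgebra B"
    for B :: "'k poly \<Rightarrow> 'k poly \<Rightarrow> 'k poly"
    using that unfolding zinbiel_prelie_bialgebra_def by blast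
  have "(1 :: 'k) \<notin> {- of_nat n |n. n \<ge> 1}"
  proof
    assume "(1 :: 'k) \<in> {- of_nat n |n. n \<ge> 1}"
    then obtain n where "(1 :: 'k) = - of_nat n" by blast
    then have "of_nat (Suc n) = (0 :: 'k)" by (simp only: of_nat_Suc add_eq_0_iff2)
    then show False by (simp del: of_nat_Suc)
  qed
  then have g1: "is_zinbiel_prelie_bialgebra (g1 1 a a (1 :: 'k))" for a
    using zinbiel_prelie_g1[of 1 1 a a] unfolding g1_conv_integral_bullet
    by (intro zinbiel_prelie_bialgebra_integral_bullet) simp
  have g4: "is_zinbiel_prelie_bialgebra (g4 (0 :: 'k))"
    using zinbiel_prelie_g4[of 0] unfolding g4_conv_integral_bullet
    by (rule zinbiel_prelie_bialgebra_integral_bullet)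
  show ?thesis
  proof (intro conjI allI impI; (elim conjE)?)
    fix N :: nat and l a b :: 'k
    assume h: "N \<ge> 1" "a \<noteq> 0" "b \<notin> {- of_nat n |n. n \<ge> 1}"
    note D = g1_com_prelie_bialgebraD[OF _ h]
    show "is_com_prelie_bialgebra (g1 N l a b) \<longleftrightarrow> N = 1 \<and> l = a \<and> b = 1"
      using D com[OF g1[of a]] by blast
    show "is_zinbiel_prelie_bialgebra (g1 N l a b) \<longleftrightarrow> N = 1 \<and> l = a \<and> b = 1"
      using D com g1[of a] by blast
  next
    fix N :: nat and l \<mu> :: 'k
    assume h: "N \<ge> 1" "\<mu> \<noteq> 0"
    show "\<not> is_com_prelie_bialgebra (g2 N l \<mu>)" "\<not> is_zinbiel_prelie_bialgebra (g2 N l \<mu>)"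
      using com g2_not_com_prelie_bialgebra[OF h] by blast+
    show "\<not> is_com_prelie_bialgebra (g3 N l \<mu>)" "\<not> is_zinbiel_prelie_bialgebra (g3 N l \<mu>)"
      using com g3_not_com_prelie_bialgebra[OF h] by blast+
  next
    fix l :: 'k
    show "is_com_prelie_bialgebra (g4 l) \<longleftrightarrow> l = 0" "is_zinbiel_prelie_bialgebra (g4 l) \<longleftrightarrow> l = 0"
      using com g4 g4_com_prelie_bialgebraD[of l] by blast+
  qed
qed

end
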